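(* Consider the scalar system $$\dot x = \theta^{0T}\varphi(t,x) + b\,u ,$$ with tracking error $e = x - x_d$ obeying $\dot e = b(\theta^{T}\varphi(t,x)+u)$, where $\theta=\theta^0/b$. Apply to it the adaptive control law $$u = -\,\mathrm{sgn}(b)\,\kappa\, e - \hat\theta^{T}\varphi(t,x) + u_1,\qquad u_1 = -\tfrac12\,\mathrm{sgn}(b)\,\gamma\,\|\varphi(t,x)\|^2 e,$$ with the adaptation law $$\hat\theta(t+\tau) = \hat\theta(t) - \mathrm{sgn}(b)\,\gamma\,\varphi(t,x(t))\,e(t)\quad\text{for } t\ge 0,\qquad \hat\theta(t)=\hat\theta_0\quad\text{for } t\in[0,\tau),$$ where $\tau,\kappa,\gamma>0$ are design parameters and $\hat\theta_0$ is the initial setting for $\hat\theta$. Then the tracking error is guaranteed to converge to zero, $$\lim_{t\to+\infty} e(t)=0,$$ while $e$ and $x$, as well as $\int_{t-\tau}^{t}\|\hat\theta(s)\|^2ds$ and $\int_{t-\tau}^{t}u^2(s)\,ds$ for $t\in[\tau,+\infty)$, are bounded.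
   Context: $x(t)\in\mathbb{R}$ is the state, $u(t)\in\mathbb{R}$ the input, $\theta^0$ a constant vector of unknown parameters, $\varphi(\cdot,\cdot)$ a vector (of the same dimension as $\theta^0$) of known continuous nonlinearities, and $b\neq 0$ an unknown constant control gain whose sign $\mathrm{sgn}(b)$ is known (it may be positive or negative); $\mathrm{sgn}$ is the sign function. A trajectory $x_d(t)$, $t\in[0,+\infty)$, is given, and $e=x-x_d$ is the tracking error. Standing relation of the setting: the error dynamics are taken to be $\dot e=b(\theta^T\varphi(t,x)+u)$ with $\theta=\theta^0/b$. $\hat\theta(t)$ is the estimate of $\theta$. $\|\cdot\|$ is the Euclidean norm.
   Formalization: The adaptation law is taken with + sgn(b) instead of − sgn(b), since the loop as written need not converge; x_d is assumed continuous and bounded, and φ(t,x) bounded uniformly in t ≥ 0 on bounded sets of x, since otherwise x or the integral of u² can be unbounded. *)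

theory Defs
  imports "HOL-Analysis.Analysis"
begin

text \<open>
  Conventions for the closed loop with delayed parameter update.

  \<^item> With \<open>\<theta> = \<theta>0 / b\<close> the error dynamics read \<open>e' = b * (\<theta> \<bullet> \<phi> t x + u)\<close>; the right-hand side is
    that of the plant \<open>x' = \<theta>0 \<bullet> \<phi> t x + b * u\<close>.  Taking the plant equation as a second, separate
    hypothesis would force the reference \<open>x\<^sub>d\<close> to be constant.

  \<^item> The estimate \<open>\<theta>hat\<close> may jump at the multiples of the delay \<open>\<tau>\<close>.  A solution is therefore a
    continuous function that satisfies the differential equation at all other positive times.

  \<^item> The estimate is updated with the sign \<open>+ sgn b\<close>, the one for which the functional
    \<open>e(t)\<^sup>2 / (2 * \<bar>b\<bar>) + (1 / (2 * \<gamma>)) * (integral over [t, t + \<tau>] of norm (\<theta> - \<theta>hat)\<^sup>2)\<close>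
    has derivative \<open>- \<kappa> * e(t)\<^sup>2\<close>.  With \<open>- sgn b\<close> the loop has positive feedback: for
    \<open>\<phi> = \<theta> = b = 1\<close>, zero reference and zero initial data, \<open>\<theta>hat\<close> stays nonpositive and \<open>e\<close> stays
    away from \<open>0\<close>.

  \<^item> The reference is bounded, and \<open>\<phi> t x\<close> is bounded uniformly in \<open>t\<close> on bounded sets of \<open>x\<close>.
    Without the former \<open>x\<close> need not be bounded; without the latter the energy of \<open>u\<close> need not be:
    for \<open>\<phi> t x = t\<close> and an exact initial estimate, \<open>e = 0\<close> and \<open>u t = - \<theta> * t\<close>.
\<close>

end

theory Submission
  imports Defs
begin

text \<open>
  Write \<open>w = \<theta> - \<theta>hat\<close> for the parameter error. The proof is a Lyapunov argument whose functional
  charges \<open>w\<close> with its energy over one delay window: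
  \<open>V t = \<gamma> / \<bar>b\<bar> * (e t)\<^sup>2 + (integral over [t, t + \<tau>] of (norm w)\<^sup>2)\<close>.
  The window integral changes at the rate \<open>(norm (w (t + \<tau>)))\<^sup>2 - (norm (w t))\<^sup>2\<close>, and since the
  update gives \<open>w (t + \<tau>)\<close> in terms of \<open>w t\<close>, \<open>e t\<close> and the regressor, this rate can be expanded:
  its cross term cancels the one in the derivative of \<open>e\<^sup>2\<close>, and its quadratic term cancels the
  nonlinear damping in the control law (\<open>lyapunov_rate\<close>). What remains is
  \<open>V t + 2 * \<gamma> * \<kappa> * (integral over [0, t] of e\<^sup>2) = V 0\<close> (\<open>window_energy_balance\<close>).

  The balance bounds \<open>e\<close>, the energy of \<open>w\<close> over every delay window, and the integral of \<open>e\<^sup>2\<close> over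
  \<open>[0, \<infinity>)\<close>. Hence \<open>x\<close> is bounded, so is the regressor along the trajectory, and both
  \<open>(norm \<theta>hat)\<^sup>2\<close> and \<open>u\<^sup>2\<close> are at most a constant plus a multiple of \<open>(norm w)\<^sup>2\<close>
  (\<open>bounded_window_integral\<close>).

  For the convergence of \<open>e\<close>, Barbalat's lemma with a bounded derivative does not apply, because \<open>w\<close>
  enters the derivative and is controlled only in mean square over a window. That control is enough:
  it keeps \<open>e\<^sup>2\<close> from dropping much in a short time, uniformly in the starting time
  (\<open>short_time_drop_bound\<close>), and a nonnegative function with this property and a bounded integral
  tends to zero (\<open>tendsto_0_if_integral_bounded\<close>).

  The estimate may jump at the multiples of \<open>\<tau>\<close>. These are isolated, and between two of them it is
  continuous with one-sided limits at the ends; so all integrals exist, and the fundamental theorem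
  of calculus holds for \<open>e\<^sup>2\<close>, which is continuous throughout.
\<close>

section \<open>Functions continuous between consecutive multiples of the delay\<close>

text \<open>
  The function \<open>p\<close> lives on the closed interval to force a limit at its right end; the value of
  \<open>h\<close> there belongs to the next piece, so \<open>h\<close> may jump.
\<close>

definition piecewise_continuous :: "real \<Rightarrow> (real \<Rightarrow> 'a::topological_space) \<Rightarrow> bool" where
  "piecewise_continuous \<tau> h \<longleftrightarrow>
    (\<forall>k::nat. \<exists>p. continuous_on {real k * \<tau>..real (Suc k) * \<tau>} p
      \<and> (\<forall>t\<in>{real k * \<tau>..<real (Suc k) * \<tau>}. h t = p t))"

lemma integrable_on_piecewise_continuous:
  fixes g :: "real \<Rightarrow> 'a::topological_space \<Rightarrow> real"
  assumes \<tau>: "\<tau> > 0" and h: "piecewise_continuous \<tau> h"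
    and g: "continuous_on ({0..} \<times> UNIV) (\<lambda>(t, y). g t y)" and a: "0 \<le> a"
  shows "(\<lambda>t. g t (h t)) integrable_on {a..c}"
proof -
  have piece: "(\<lambda>t. g t (h t)) integrable_on {real k * \<tau>..real (Suc k) * \<tau>}" for k :: nat
  proof -
    obtain p where p: "continuous_on {real k * \<tau>..real (Suc k) * \<tau>} p"
      and hp: "\<And>t. t \<in> {real k * \<tau>..<real (Suc k) * \<tau>} \<Longrightarrow> h t = p t"
      using h unfolding piecewise_continuous_def by blast
    have "{real k * \<tau>..real (Suc k) * \<tau>} \<subseteq> {0..}"
      using \<tau> by (auto intro: order_trans[rotated])
    then have image: "(\<lambda>t. (t, p t)) ` {real k * \<tau>..real (Suc k) * \<tau>} \<subseteq> {0..} \<times> UNIV"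
      by auto
    have "continuous_on {real k * \<tau>..real (Suc k) * \<tau>} (\<lambda>t. (t, p t))"
      using p by (intro continuous_intros)
    then have "continuous_on {real k * \<tau>..real (Suc k) * \<tau>} (\<lambda>t. g t (p t))"
      using continuous_on_compose2[OF g _ image] by simp
    then have "(\<lambda>t. g t (p t)) integrable_on {real k * \<tau>..real (Suc k) * \<tau>}"
      by (rule integrable_continuous_interval)
    then show ?thesis
      by (rule integrable_spike_finite[of "{real (Suc k) * \<tau>}", rotated 2]) (auto simp: hp)
  qed
  have initial: "(\<lambda>t. g t (h t)) integrable_on {0..real k * \<tau>}" for k :: nat
  proof (induction k)
    case 0
    show ?case
      using integrable_on_refl[of "\<lambda>t. g t (h t)" 0] by simp
  next
    case (Suc k)
    show ?case
      by (rule Henstock_Kurzweil_Integration.integrable_combine[OF _ _ Suc piece[of k]]) (use \<tau> in auto)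
  qed
  obtain k :: nat where "c / \<tau> \<le> real k"
    using real_arch_simple by blast
  then have "c \<le> real k * \<tau>"
    using \<tau> by (simp add: field_simps)
  then show ?thesis
    using integrable_subinterval_real[OF initial[of k]] a by auto
qed

text \<open>
  On each delay period the estimate is the previous period's estimate, shifted, plus a continuous
  correction, so a continuous extension to the closed period is passed on from period to period.
\<close>

lemma piecewise_continuous_delayed_update:
  fixes h v :: "real \<Rightarrow> 'a::real_normed_vector"
  assumes \<tau>: "\<tau> > 0" and v: "continuous_on {0..} v"
    and init: "\<And>t. t \<in> {0..<\<tau>} \<Longrightarrow> h t = h0"
    and update: "\<And>t. 0 \<le> t \<Longrightarrow> h (t + \<tau>) = h t + v t"
  shows "piecewise_continuous \<tau> h"
proof -
  have "\<exists>p. continuous_on {real k * \<tau>..real (Suc k) * \<tau>} p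
      \<and> (\<forall>t\<in>{real k * \<tau>..<real (Suc k) * \<tau>}. h t = p t)" for k :: nat
  proof (induction k)
    case 0
    show ?case
      by (rule exI[of _ "\<lambda>_. h0"]) (use init in auto)
  next
    case (Suc k)
    then obtain p where p: "continuous_on {real k * \<tau>..real (Suc k) * \<tau>} p"
      and hp: "\<And>t. t \<in> {real k * \<tau>..<real (Suc k) * \<tau>} \<Longrightarrow> h t = p t"
      by blast
    have "0 \<le> real k * \<tau>"
      using \<tau> by simp
    then have sub: "{real k * \<tau>..real (Suc k) * \<tau>} \<subseteq> {0..}"
      by auto
    have "continuous_on {real k * \<tau>..real (Suc k) * \<tau>} (\<lambda>t. p t + v t)"
      by (intro continuous_on_add p continuous_on_subset[OF v sub])
    then have "continuous_on {real (Suc k) * \<tau>..real (Suc (Suc k)) * \<tau>}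
        (\<lambda>t. p (t - \<tau>) + v (t - \<tau>))"
      by (rule continuous_on_compose2[where f = "\<lambda>t. t - \<tau>"])
        (auto intro!: continuous_intros simp: algebra_simps)
    moreover have "h t = p (t - \<tau>) + v (t - \<tau>)"
      if "t \<in> {real (Suc k) * \<tau>..<real (Suc (Suc k)) * \<tau>}" for t
    proof -
      have "t - \<tau> \<in> {real k * \<tau>..<real (Suc k) * \<tau>}"
        using that by (auto simp: algebra_simps)
      then show ?thesis
        using update[of "t - \<tau>"] hp[of "t - \<tau>"] sub by auto
    qed
    ultimately show ?case by blast
  qed
  then show ?thesis
    unfolding piecewise_continuous_def by blast
qed

lemma finite_multiples_in_interval:
  fixes \<tau> :: real
  assumes "\<tau> > 0"
  shows "finite (range (\<lambda>k::nat. real k * \<tau>) \<inter> {a..c})"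
proof -
  obtain n :: nat where "c / \<tau> \<le> real n"
    using real_arch_simple by blast
  then have n: "c \<le> real n * \<tau>"
    using assms by (simp add: field_simps)
  have "range (\<lambda>k::nat. real k * \<tau>) \<inter> {a..c} \<subseteq> (\<lambda>k. real k * \<tau>) ` {..n}"
  proof
    fix y assume "y \<in> range (\<lambda>k::nat. real k * \<tau>) \<inter> {a..c}"
    then obtain k :: nat where y: "y = real k * \<tau>" "y \<le> c"
      by auto
    then have "real k * \<tau> \<le> real n * \<tau>"
      using n by simp
    then have "k \<le> n"
      using assms by simp
    then show "y \<in> (\<lambda>k. real k * \<tau>) ` {..n}"
      using y by auto
  qed
  then show ?thesis
    by (rule finite_subset) simp
qed

lemma has_integral_derivative_off_multiples:
  fixes f :: "real \<Rightarrow> real"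
  assumes \<tau>: "\<tau> > 0" and f: "continuous_on {0..} f"
    and deriv: "\<And>t. 0 < t \<Longrightarrow> t \<notin> range (\<lambda>k::nat. real k * \<tau>) \<Longrightarrow>
      (f has_real_derivative f' t) (at t)"
    and ac: "0 \<le> a" "a \<le> c"
  shows "(f' has_integral (f c - f a)) {a..c}"
proof (rule fundamental_theorem_of_calculus_interior_strong[OF finite_multiples_in_interval[OF \<tau>, of a c]])
  show "continuous_on {a..c} f"
    using f ac by (auto intro: continuous_on_subset)
  show "(f has_vector_derivative f' t) (at t)"
    if "t \<in> {a<..<c} - range (\<lambda>k::nat. real k * \<tau>) \<inter> {a..c}" for t
    unfolding has_real_derivative_iff_has_vector_derivative[symmetric]
    using that ac by (intro deriv) auto
qed (use ac in simp)

section \<open>The energy balance over a sliding window\<close>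

text \<open>
  The integral over \<open>[a, c]\<close> of the increments \<open>m (s + \<tau>) - m s\<close> telescopes to the difference of
  the two window integrals of \<open>m\<close>, starting at \<open>c\<close> and at \<open>a\<close>.
\<close>

lemma window_energy_balance:
  fixes f m q :: "real \<Rightarrow> real"
  assumes \<tau>: "\<tau> > 0" and f: "continuous_on {0..} f" and q: "continuous_on {0..} q"
    and m: "\<And>a c. 0 \<le> a \<Longrightarrow> m integrable_on {a..c}"
    and deriv: "\<And>t. 0 < t \<Longrightarrow> t \<notin> range (\<lambda>k::nat. real k * \<tau>) \<Longrightarrow>
      (f has_real_derivative - q t - (m (t + \<tau>) - m t)) (at t)"
    and ac: "0 \<le> a" "a \<le> c"
  shows "f c + integral {c..c + \<tau>} m + integral {a..c} q = f a + integral {a..a + \<tau>} m"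
proof -
  have D: "((\<lambda>t. - q t - (m (t + \<tau>) - m t)) has_integral (f c - f a)) {a..c}"
    by (rule has_integral_derivative_off_multiples[OF \<tau> f deriv ac])
  have qi: "q integrable_on {a..c}"
    by (rule integrable_continuous_interval[OF continuous_on_subset[OF q]]) (use ac in auto)
  have "(m has_integral integral {a + \<tau>..c + \<tau>} m) {a + \<tau>..c + \<tau>}"
    using m[of "a + \<tau>" "c + \<tau>"] ac \<tau> by (simp add: has_integral_integral[symmetric])
  then have shifted: "((\<lambda>t. m (t + \<tau>)) has_integral integral {a + \<tau>..c + \<tau>} m) {a..c}"
    by (simp add: has_integral_shift_real_ivl_iff[of m _ "a + \<tau>" "c + \<tau>" \<tau>])
  have "((\<lambda>t. - q t - (m (t + \<tau>) - m t)) has_integral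
      (- integral {a..c} q - (integral {a + \<tau>..c + \<tau>} m - integral {a..c} m))) {a..c}"
    by (intro has_integral_diff has_integral_neg shifted integrable_integral qi m ac)
  then have "f c - f a = - integral {a..c} q - (integral {a + \<tau>..c + \<tau>} m - integral {a..c} m)"
    using D has_integral_unique by blast
  moreover have "integral {a..a + \<tau>} m + integral {a + \<tau>..c + \<tau>} m = integral {a..c + \<tau>} m"
    by (rule Henstock_Kurzweil_Integration.integral_combine) (use m ac \<tau> in auto)
  moreover have "integral {a..c} m + integral {c..c + \<tau>} m = integral {a..c + \<tau>} m"
    by (rule Henstock_Kurzweil_Integration.integral_combine) (use m ac \<tau> in auto)
  ultimately show ?thesis by linarith
qed

lemma bounded_window_integral:
  fixes f m :: "real \<Rightarrow> real"
  assumes \<tau>: "\<tau> > 0" and Q: "0 \<le> Q"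
    and f: "\<And>a c. 0 \<le> a \<Longrightarrow> f integrable_on {a..c}"
    and m: "\<And>a c. 0 \<le> a \<Longrightarrow> m integrable_on {a..c}"
    and m_bound: "\<And>t. 0 \<le> t \<Longrightarrow> integral {t..t + \<tau>} m \<le> B"
    and f_bound: "\<And>t. 0 \<le> t \<Longrightarrow> 0 \<le> f t \<and> f t \<le> P + Q * m t"
  shows "bounded ((\<lambda>t. integral {t - \<tau>..t} f) ` {\<tau>..})"
proof -
  have "\<bar>integral {t - \<tau>..t} f\<bar> \<le> \<tau> * P + Q * B" if t: "t \<in> {\<tau>..}" for t
  proof -
    have t0: "0 \<le> t - \<tau>"
      using t by simp
    have nonneg: "0 \<le> integral {t - \<tau>..t} f"
      by (rule integral_nonneg) (use f t0 f_bound in auto)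
    have "((\<lambda>s. P + Q * m s) has_integral (\<tau> * P + Q * integral {t - \<tau>..t} m)) {t - \<tau>..t}"
      using \<tau> t0 by (intro has_integral_add has_integral_mult_right integrable_integral m)
        (use has_integral_const_real[of P "t - \<tau>" t] in simp_all)
    then have "integral {t - \<tau>..t} f \<le> \<tau> * P + Q * integral {t - \<tau>..t} m"
      by (rule has_integral_le[OF integrable_integral[OF f[OF t0]]]) (use f_bound t0 in auto)
    also have "\<dots> \<le> \<tau> * P + Q * B"
      using m_bound[OF t0] Q by (simp add: mult_left_mono)
    finally show ?thesis
      using nonneg by simp
  qed
  then show ?thesis
    by (auto simp: bounded_iff)
qed

section \<open>Convergence from an integrable square\<close>

text \<open>
  The slope \<open>C + A * v\<close> need not be bounded, but \<open>v \<le> 1 / (2 * \<epsilon>) + \<epsilon> / 2 * v\<^sup>2\<close>: a small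
  \<open>\<epsilon>\<close> makes the contribution of the window energy of \<open>v\<close> small, and then a short time makes the
  constant part small.
\<close>

lemma short_time_drop_bound:
  fixes g g' v :: "real \<Rightarrow> real"
  assumes \<tau>: "\<tau> > 0" and AC: "0 \<le> A" "0 \<le> C" and B: "0 \<le> B"
    and g: "continuous_on {0..} g"
    and deriv: "\<And>t. 0 < t \<Longrightarrow> t \<notin> range (\<lambda>k::nat. real k * \<tau>) \<Longrightarrow>
      (g has_real_derivative g' t) (at t)"
    and g': "\<And>t. 0 \<le> t \<Longrightarrow> - g' t \<le> C + A * v t"
    and v: "\<And>a c. 0 \<le> a \<Longrightarrow> (\<lambda>t. (v t)\<^sup>2) integrable_on {a..c}"
    and v_energy: "\<And>t. 0 \<le> t \<Longrightarrow> integral {t..t + \<tau>} (\<lambda>s. (v s)\<^sup>2) \<le> B"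
    and \<eta>: "\<eta> > 0"
  shows "\<exists>\<delta>>0. \<forall>t\<ge>0. \<forall>s\<in>{t..t + \<delta>}. g t \<le> g s + \<eta>"
proof -
  define \<epsilon> where "\<epsilon> = \<eta> / (A * B + 1)"
  define K where "K = C + A / (2 * \<epsilon>) + 1"
  define \<delta> where "\<delta> = min \<tau> (\<eta> / (2 * K))"
  have AB: "0 \<le> A * B"
    using AC B by simp
  then have \<epsilon>: "\<epsilon> > 0"
    unfolding \<epsilon>_def using \<eta> by (intro divide_pos_pos) linarith+
  have K: "K > 0"
  proof -
    have "0 \<le> A / (2 * \<epsilon>)"
      using AC \<epsilon> by simp
    then show ?thesis
      unfolding K_def using AC by linarith
  qed
  have \<delta>: "\<delta> > 0"
    unfolding \<delta>_def using \<tau> \<eta> K by simp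
  have "\<epsilon> * (A * B) \<le> \<eta>"
    unfolding \<epsilon>_def using \<eta> AB by (simp add: field_simps)
  then have energy_part: "A * \<epsilon> / 2 * B \<le> \<eta> / 2"
    by (simp add: algebra_simps)
  have time_part: "\<delta> * K \<le> \<eta> / 2"
  proof -
    have "\<delta> * K \<le> \<eta> / (2 * K) * K"
      using K by (intro mult_right_mono) (simp_all add: \<delta>_def)
    then show ?thesis
      using K by simp
  qed
  have slope: "- g' t \<le> K + A * \<epsilon> / 2 * (v t)\<^sup>2" if "0 \<le> t" for t
  proof -
    have "0 \<le> (\<epsilon> * v t - 1)\<^sup>2"
      by simp
    then have "v t \<le> 1 / (2 * \<epsilon>) + \<epsilon> / 2 * (v t)\<^sup>2"
      using \<epsilon> by (simp add: field_simps power2_eq_square)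
    then have "A * v t \<le> A * (1 / (2 * \<epsilon>) + \<epsilon> / 2 * (v t)\<^sup>2)"
      using AC(1) by (rule mult_left_mono)
    then show ?thesis
      using g'[OF that] unfolding K_def by (simp add: algebra_simps)
  qed
  have "g t \<le> g s + \<eta>" if t: "0 \<le> t" and s: "s \<in> {t..t + \<delta>}" for t s
  proof -
    have ts: "t \<le> s" "s \<le> t + \<tau>" "s - t \<le> \<delta>"
      using s by (auto simp: \<delta>_def)
    have "(g' has_integral (g s - g t)) {t..s}"
      by (rule has_integral_derivative_off_multiples[OF \<tau> g deriv t ts(1)])
    then have "((\<lambda>r. - g' r) has_integral - (g s - g t)) {t..s}"
      by (rule has_integral_neg)
    moreover have "((\<lambda>r. K + A * \<epsilon> / 2 * (v r)\<^sup>2) has_integral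
        ((s - t) * K + A * \<epsilon> / 2 * integral {t..s} (\<lambda>r. (v r)\<^sup>2))) {t..s}"
      using ts t by (intro has_integral_add has_integral_mult_right integrable_integral v)
        (use has_integral_const_real[of K t s] in simp_all)
    ultimately have "- (g s - g t) \<le> (s - t) * K + A * \<epsilon> / 2 * integral {t..s} (\<lambda>r. (v r)\<^sup>2)"
      by (rule has_integral_le) (use slope t in auto)
    also have "\<dots> \<le> \<delta> * K + A * \<epsilon> / 2 * B"
    proof (rule add_mono)
      show "(s - t) * K \<le> \<delta> * K"
        using ts K by (intro mult_right_mono) auto
      have "integral {t..s} (\<lambda>r. (v r)\<^sup>2) \<le> integral {t..t + \<tau>} (\<lambda>r. (v r)\<^sup>2)"
        by (rule integral_subset_le) (use v t ts in auto)
      also have "\<dots> \<le> B"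
        by (rule v_energy[OF t])
      finally show "A * \<epsilon> / 2 * integral {t..s} (\<lambda>r. (v r)\<^sup>2) \<le> A * \<epsilon> / 2 * B"
        using AC \<epsilon> by (intro mult_left_mono) auto
    qed
    also have "\<dots> \<le> \<eta>"
      using energy_part time_part by linarith
    finally show ?thesis by linarith
  qed
  then show ?thesis
    using \<delta> by blast
qed

text \<open>
  A variant of Barbalat's lemma: it is enough that the function cannot drop quickly. A late value
  \<open>\<ge> \<eta>\<close> would keep it above \<open>\<eta> / 2\<close> for a fixed time and so contribute a fixed amount to
  the integral, while the increments of the convergent integral tend to zero.
\<close>

lemma tendsto_0_if_integral_bounded:
  fixes g :: "real \<Rightarrow> real"
  assumes g: "continuous_on {0..} g" and nonneg: "\<And>t. 0 \<le> t \<Longrightarrow> 0 \<le> g t"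
    and bound: "\<And>t. 0 \<le> t \<Longrightarrow> integral {0..t} g \<le> J"
    and drop: "\<And>\<eta>. 0 < \<eta> \<Longrightarrow> \<exists>\<delta>>0. \<forall>t\<ge>0. \<forall>s\<in>{t..t + \<delta>}. g t \<le> g s + \<eta>"
  shows "(g \<longlongrightarrow> 0) at_top"
proof (rule tendstoI)
  fix \<eta> :: real assume \<eta>: "0 < \<eta>"
  obtain \<delta> where \<delta>: "\<delta> > 0" and slow: "\<And>t s. 0 \<le> t \<Longrightarrow> s \<in> {t..t + \<delta>} \<Longrightarrow> g t \<le> g s + \<eta> / 2"
    using drop[of "\<eta> / 2"] \<eta> by auto
  define S where "S = (SUP t\<in>{0..}. integral {0..t} g)"
  have bdd: "bdd_above ((\<lambda>t. integral {0..t} g) ` {0..})"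
    using bound by (intro bdd_aboveI[of _ J]) auto
  have int: "g integrable_on {a..c}" if "0 \<le> a" for a c
    by (rule integrable_continuous_interval[OF continuous_on_subset[OF g]]) (use that in auto)
  have "S - \<delta> * \<eta> / 2 < S"
    using \<delta> \<eta> by simp
  then obtain T where T: "0 \<le> T" "S - \<delta> * \<eta> / 2 < integral {0..T} g"
    unfolding S_def using less_cSUP_iff[OF _ bdd] by auto
  have "g t < \<eta>" if t: "T \<le> t" for t
  proof (rule ccontr)
    assume "\<not> g t < \<eta>"
    then have big: "\<eta> / 2 \<le> g s" if "s \<in> {t..t + \<delta>}" for s
      using slow[OF _ that] T t by linarith
    have "((\<lambda>_. \<eta> / 2) has_integral \<delta> * (\<eta> / 2)) {t..t + \<delta>}"
      using has_integral_const_real[of "\<eta> / 2" t "t + \<delta>"] \<delta> by simp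
    then have "\<delta> * (\<eta> / 2) \<le> integral {t..t + \<delta>} g"
      by (rule has_integral_le[OF _ integrable_integral[OF int]]) (use big T t in auto)
    moreover have "integral {0..t} g + integral {t..t + \<delta>} g = integral {0..t + \<delta>} g"
      by (rule Henstock_Kurzweil_Integration.integral_combine) (use T t \<delta> int in auto)
    moreover have "integral {0..T} g \<le> integral {0..t} g"
      by (rule integral_subset_le) (use T t int nonneg in auto)
    moreover have "integral {0..t + \<delta>} g \<le> S"
      unfolding S_def by (rule cSUP_upper[OF _ bdd]) (use T t \<delta> in auto)
    ultimately show False
      using T by simp
  qed
  then have "\<forall>t\<ge>T. dist (g t) 0 < \<eta>"
    using nonneg T by auto
  then show "\<forall>\<^sub>F t in at_top. dist (g t) 0 < \<eta>"
    using eventually_at_top_linorder by blast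
qed

section \<open>The closed loop\<close>

lemma closed_loop_error_rate:
  fixes \<theta> h p :: "'a::real_inner" and b \<kappa> \<gamma> e :: real
  shows "b * (\<theta> \<bullet> p + (- sgn b * \<kappa> * e - h \<bullet> p + - (1/2) * sgn b * \<gamma> * (norm p)\<^sup>2 * e))
    = b * ((\<theta> - h) \<bullet> p) - \<bar>b\<bar> * \<kappa> * e - \<bar>b\<bar> * \<gamma> * (norm p)\<^sup>2 * e / 2"
  unfolding abs_sgn[of b] by (simp add: algebra_simps inner_diff_left)

text \<open>
  Both cross terms, the one in the derivative of \<open>e\<^sup>2\<close> and the one in the increment of the squared
  parameter error over one delay, are multiples of \<open>e * ((\<theta> - h) \<bullet> p)\<close>, and the sign and the gain of
  the update make them cancel. The square of the update itself is what the damping term with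
  \<open>(norm p)\<^sup>2\<close> in the control law pays for.
\<close>

lemma lyapunov_rate:
  fixes \<theta> h p :: "'a::real_inner" and b \<kappa> \<gamma> e e' :: real
  assumes b: "b \<noteq> 0"
    and e': "e' = b * ((\<theta> - h) \<bullet> p) - \<bar>b\<bar> * \<kappa> * e - \<bar>b\<bar> * \<gamma> * (norm p)\<^sup>2 * e / 2"
  shows "2 * \<gamma> / \<bar>b\<bar> * (e * e') = - (2 * \<gamma> * \<kappa> * e\<^sup>2)
    - ((norm (\<theta> - (h + (sgn b * \<gamma> * e) *\<^sub>R p)))\<^sup>2 - (norm (\<theta> - h))\<^sup>2)"
proof -
  define w where "w = \<theta> - h"
  define r where "r = sgn b * \<gamma> * e"
  have sgn_sq: "sgn b * sgn b = 1"
    using b by (auto simp: sgn_if)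
  have expand: "(norm (w - r *\<^sub>R p))\<^sup>2 = (norm w)\<^sup>2 - 2 * r * (w \<bullet> p) + r\<^sup>2 * (norm p)\<^sup>2"
    unfolding power2_norm_eq_inner
    by (simp add: inner_diff_left inner_diff_right inner_commute power2_eq_square algebra_simps)
  have "b / \<bar>b\<bar> = sgn b"
    by (simp add: sgn_if)
  then have "2 * \<gamma> / \<bar>b\<bar> * (e * e') = 2 * \<gamma> * e * (sgn b * (w \<bullet> p) - \<kappa> * e - \<gamma> * (norm p)\<^sup>2 * e / 2)"
    unfolding e' w_def[symmetric] using b by (auto simp: field_simps)
  also have "\<dots> = - (2 * \<gamma> * \<kappa> * e\<^sup>2) + 2 * r * (w \<bullet> p) - (\<gamma> * e)\<^sup>2 * (norm p)\<^sup>2"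
    unfolding r_def by (simp add: algebra_simps power2_eq_square)
  also have "(\<gamma> * e)\<^sup>2 = r\<^sup>2"
    unfolding r_def using sgn_sq by (simp add: power2_eq_square algebra_simps)
  also have "- (2 * \<gamma> * \<kappa> * e\<^sup>2) + 2 * r * (w \<bullet> p) - r\<^sup>2 * (norm p)\<^sup>2
      = - (2 * \<gamma> * \<kappa> * e\<^sup>2) - ((norm (w - r *\<^sub>R p))\<^sup>2 - (norm w)\<^sup>2)"
    using expand by simp
  also have "w - r *\<^sub>R p = \<theta> - (h + (sgn b * \<gamma> * e) *\<^sub>R p)"
    by (simp add: w_def r_def)
  finally show ?thesis
    by (simp add: w_def)
qed

theorem theorem2:
  fixes x x\<^sub>d e u u\<^sub>1 :: "real \<Rightarrow> real"
    and \<phi> :: "real \<Rightarrow> real \<Rightarrow> real ^ 'n"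
    and \<theta>hat :: "real \<Rightarrow> real ^ 'n"
    and \<theta>0 \<theta> \<theta>hat0 :: "real ^ 'n"
    and b \<tau> \<kappa> \<gamma> :: real
  assumes b: "b \<noteq> 0"
    and design: "\<tau> > 0" "\<kappa> > 0" "\<gamma> > 0"
    and \<phi>_continuous: "continuous_on ({0..} \<times> UNIV) (\<lambda>(t, y). \<phi> t y)"
    and \<phi>_bounded: "\<And>r. bounded ((\<lambda>(t, y). \<phi> t y) ` ({0..} \<times> {-r..r}))"
    and reference: "continuous_on {0..} x\<^sub>d" "bounded (x\<^sub>d ` {0..})"
    and state: "continuous_on {0..} x"
    and error: "\<And>t. t \<ge> 0 \<Longrightarrow> e t = x t - x\<^sub>d t"
    and \<theta>: "\<theta> = \<theta>0 /\<^sub>R b"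
    and error_dynamics: "\<And>t. t > 0 \<Longrightarrow> t \<notin> range (\<lambda>k::nat. real k * \<tau>) \<Longrightarrow>
          (e has_real_derivative b * (\<theta> \<bullet> \<phi> t (x t) + u t)) (at t)"
    and control: "\<And>t. t \<ge> 0 \<Longrightarrow>
          u t = - sgn b * \<kappa> * e t - \<theta>hat t \<bullet> \<phi> t (x t) + u\<^sub>1 t"
    and control_1: "\<And>t. t \<ge> 0 \<Longrightarrow>
          u\<^sub>1 t = - (1/2) * sgn b * \<gamma> * (norm (\<phi> t (x t)))\<^sup>2 * e t"
    and adaptation: "\<And>t. t \<ge> 0 \<Longrightarrow>
          \<theta>hat (t + \<tau>) = \<theta>hat t + (sgn b * \<gamma> * e t) *\<^sub>R \<phi> t (x t)"
    and initial_estimate: "\<And>t. t \<in> {0..<\<tau>} \<Longrightarrow> \<theta>hat t = \<theta>hat0"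
  shows "(e \<longlongrightarrow> 0) at_top
    \<and> bounded (e ` {0..})
    \<and> bounded (x ` {0..})
    \<and> (\<forall>t\<ge>\<tau>. (\<lambda>s. (norm (\<theta>hat s))\<^sup>2) integrable_on {t - \<tau>..t})
    \<and> bounded ((\<lambda>t. integral {t - \<tau>..t} (\<lambda>s. (norm (\<theta>hat s))\<^sup>2)) ` {\<tau>..})
    \<and> (\<forall>t\<ge>\<tau>. (\<lambda>s. (u s)\<^sup>2) integrable_on {t - \<tau>..t})
    \<and> bounded ((\<lambda>t. integral {t - \<tau>..t} (\<lambda>s. (u s)\<^sup>2)) ` {\<tau>..})"
proof -
  define p where "p t = \<phi> t (x t)" for t
  define w where "w t = norm (\<theta> - \<theta>hat t)" for t
  define e' where "e' t = b * ((\<theta> - \<theta>hat t) \<bullet> p t) - \<bar>b\<bar> * \<kappa> * e t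
    - \<bar>b\<bar> * \<gamma> * (norm (p t))\<^sup>2 * e t / 2" for t
  define G where "G = \<gamma> / \<bar>b\<bar>"
  define f where "f t = G * (e t)\<^sup>2" for t
  note tau = design(1)
  have gain: "G > 0"
    using b design by (simp add: G_def)
  have e_cont: "continuous_on {0..} e"
    using continuous_on_cong[THEN iffD2, OF refl error continuous_on_diff[OF state reference(1)]]
    by simp
  have "continuous_on {0..} (\<lambda>t. (t, x t))"
    by (intro continuous_intros state)
  then have p_cont: "continuous_on {0..} p"
    unfolding p_def using continuous_on_compose2[OF \<phi>_continuous, of "{0..}" "\<lambda>t. (t, x t)"]
    by auto
  have u_eq: "u t = - sgn b * \<kappa> * e t - \<theta>hat t \<bullet> p t
      + - (1/2) * sgn b * \<gamma> * (norm (p t))\<^sup>2 * e t" if "0 \<le> t" for t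
    using control[OF that] control_1[OF that] by (simp add: p_def)
  have e_deriv: "(e has_real_derivative e' t) (at t)"
    if "0 < t" "t \<notin> range (\<lambda>k::nat. real k * \<tau>)" for t
  proof -
    have "b * (\<theta> \<bullet> p t + u t) = e' t"
      using u_eq[of t] that closed_loop_error_rate[of b \<theta> "p t"] by (simp add: e'_def)
    then show ?thesis
      using error_dynamics[OF that] by (simp add: p_def)
  qed

  have e2_deriv: "((\<lambda>t. (e t)\<^sup>2) has_real_derivative 2 * (e t * e' t)) (at t)"
    if "0 < t" "t \<notin> range (\<lambda>k::nat. real k * \<tau>)" for t
    by (auto intro!: derivative_eq_intros e_deriv[OF that])

  have pc: "piecewise_continuous \<tau> \<theta>hat"
  proof (rule piecewise_continuous_delayed_update[OF tau _ initial_estimate])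
    show "continuous_on {0..} (\<lambda>t. (sgn b * \<gamma> * e t) *\<^sub>R p t)"
      by (intro continuous_intros e_cont p_cont)
  qed (use adaptation in \<open>auto simp: p_def\<close>)
  have w_int: "(\<lambda>s. (w s)\<^sup>2) integrable_on {a..c}" if "0 \<le> a" for a c
    unfolding w_def
    by (rule integrable_on_piecewise_continuous[OF tau pc, where g = "\<lambda>_ y. (norm (\<theta> - y))\<^sup>2"])
      (use that in \<open>auto simp: split_beta intro!: continuous_intros\<close>)
  have \<theta>hat_int: "(\<lambda>s. (norm (\<theta>hat s))\<^sup>2) integrable_on {a..c}" if "0 \<le> a" for a c
    by (rule integrable_on_piecewise_continuous[OF tau pc, where g = "\<lambda>_ y. (norm y)\<^sup>2"])
      (use that in \<open>auto simp: split_beta intro!: continuous_intros\<close>)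
  have u_int: "(\<lambda>s. (u s)\<^sup>2) integrable_on {a..c}" if a: "0 \<le> a" for a c
  proof -
    have e2: "continuous_on ({0..} \<times> UNIV) (\<lambda>z :: real \<times> (real ^ 'n). e (fst z))"
      by (rule continuous_on_compose2[OF e_cont]) (auto intro!: continuous_intros)
    have p2: "continuous_on ({0..} \<times> UNIV) (\<lambda>z :: real \<times> (real ^ 'n). p (fst z))"
      by (rule continuous_on_compose2[OF p_cont]) (auto intro!: continuous_intros)
    have "(\<lambda>t. (- sgn b * \<kappa> * e t - \<theta>hat t \<bullet> p t
      + - (1/2) * sgn b * \<gamma> * (norm (p t))\<^sup>2 * e t)\<^sup>2) integrable_on {a..c}"
      by (rule integrable_on_piecewise_continuous[OF tau pc, where g = "\<lambda>t y.
            (- sgn b * \<kappa> * e t - y \<bullet> p t + - (1/2) * sgn b * \<gamma> * (norm (p t))\<^sup>2 * e t)\<^sup>2"])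
        (use a e2 p2 in \<open>auto simp: split_beta intro!: continuous_intros\<close>)
    then show ?thesis
      by (rule integrable_eq) (use u_eq a in auto)
  qed

  define V where "V t = f t + integral {t..t + \<tau>} (\<lambda>s. (w s)\<^sup>2)" for t
  have e2_cont: "continuous_on {0..} (\<lambda>t. (e t)\<^sup>2)"
    by (intro continuous_intros e_cont)
  have V_balance: "V t + 2 * \<gamma> * \<kappa> * integral {0..t} (\<lambda>s. (e s)\<^sup>2) = V 0" if t: "0 \<le> t" for t
  proof -
    have "f t + integral {t..t + \<tau>} (\<lambda>s. (w s)\<^sup>2) + integral {0..t} (\<lambda>s. 2 * \<gamma> * \<kappa> * (e s)\<^sup>2)
        = f 0 + integral {0..0 + \<tau>} (\<lambda>s. (w s)\<^sup>2)"
    proof (rule window_energy_balance[OF tau _ _ w_int])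
      show "continuous_on {0..} f"
        unfolding f_def by (intro continuous_intros e_cont)
      show "continuous_on {0..} (\<lambda>s. 2 * \<gamma> * \<kappa> * (e s)\<^sup>2)"
        by (intro continuous_intros e_cont)
      fix s :: real
      assume s: "0 < s" "s \<notin> range (\<lambda>k::nat. real k * \<tau>)"
      have "(f has_real_derivative 2 * \<gamma> / \<bar>b\<bar> * (e s * e' s)) (at s)"
        unfolding f_def using DERIV_cmult[OF e2_deriv[OF s], of G] by (simp add: G_def mult_ac)
      also have "2 * \<gamma> / \<bar>b\<bar> * (e s * e' s)
          = - (2 * \<gamma> * \<kappa> * (e s)\<^sup>2) - ((w (s + \<tau>))\<^sup>2 - (w s)\<^sup>2)"
        using lyapunov_rate[OF b e'_def] adaptation[of s] s by (simp add: w_def p_def)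
      finally show "(f has_real_derivative
          - (2 * \<gamma> * \<kappa> * (e s)\<^sup>2) - ((w (s + \<tau>))\<^sup>2 - (w s)\<^sup>2)) (at s)" .
    qed (use t in auto)
    then show ?thesis
      by (simp add: V_def)
  qed
  have f_nonneg: "0 \<le> f t" for t
    using gain by (simp add: f_def)
  have w_window_nonneg: "0 \<le> integral {t..t + \<tau>} (\<lambda>s. (w s)\<^sup>2)" if "0 \<le> t" for t
    by (rule integral_nonneg) (use w_int that in auto)
  have e2_int_nonneg: "0 \<le> integral {0..t} (\<lambda>s. (e s)\<^sup>2)" for t
    by (rule integral_nonneg)
      (auto intro!: integrable_continuous_interval continuous_on_subset[OF e2_cont])
  have \<gamma>\<kappa>: "2 * \<gamma> * \<kappa> > 0"
    using design by simp
  have V_le: "V t \<le> V 0" if "0 \<le> t" for t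
  proof -
    have "0 \<le> 2 * \<gamma> * \<kappa> * integral {0..t} (\<lambda>s. (e s)\<^sup>2)"
      by (rule mult_nonneg_nonneg[OF less_imp_le[OF \<gamma>\<kappa>] e2_int_nonneg])
    then show ?thesis
      using V_balance[OF that] by linarith
  qed
  have V_nonneg: "0 \<le> V t" if "0 \<le> t" for t
    using f_nonneg w_window_nonneg[OF that] by (simp add: V_def)
  have w_window: "integral {t..t + \<tau>} (\<lambda>s. (w s)\<^sup>2) \<le> V 0" if "0 \<le> t" for t
    using V_le[OF that] f_nonneg[of t] by (simp add: V_def)
  have e2_int: "integral {0..t} (\<lambda>s. (e s)\<^sup>2) \<le> V 0 / (2 * \<gamma> * \<kappa>)" if "0 \<le> t" for t
  proof -
    have "integral {0..t} (\<lambda>s. (e s)\<^sup>2) * (2 * \<gamma> * \<kappa>) \<le> V 0"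
      using V_balance[OF that] V_nonneg[OF that] by (simp add: mult.commute)
    then show ?thesis
      using \<gamma>\<kappa> by (simp add: pos_le_divide_eq)
  qed

  define E where "E = sqrt (V 0 / G)"
  have e_le: "\<bar>e t\<bar> \<le> E" if "0 \<le> t" for t
  proof -
    have "(e t)\<^sup>2 * G \<le> V 0"
      using V_le[OF that] w_window_nonneg[OF that] by (simp add: V_def f_def mult.commute)
    then have "(e t)\<^sup>2 \<le> V 0 / G"
      using gain by (simp add: pos_le_divide_eq)
    then show ?thesis
      unfolding E_def using real_le_rsqrt[of "\<bar>e t\<bar>"] by simp
  qed
  then have E: "0 \<le> E"
    using order_trans[OF abs_ge_zero, of "e 0" E] by simp
  obtain X where X: "\<And>t. 0 \<le> t \<Longrightarrow> \<bar>x\<^sub>d t\<bar> \<le> X"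
    using reference(2) by (auto simp: bounded_iff)
  have x_le: "\<bar>x t\<bar> \<le> E + X" if "0 \<le> t" for t
    using e_le[OF that] X[OF that] error[OF that] by linarith
  obtain M where "\<forall>z\<in>{0..} \<times> {- (E + X)..E + X}. norm (case z of (t, y) \<Rightarrow> \<phi> t y) \<le> M"
    using \<phi>_bounded[of "E + X"] unfolding bounded_iff by blast
  then have M: "norm (\<phi> t y) \<le> M" if "0 \<le> t" "y \<in> {- (E + X)..E + X}" for t y
    using that by fastforce
  have p_le: "norm (p t) \<le> M" if "0 \<le> t" for t
    unfolding p_def using x_le[OF that] by (intro M that) auto
  then have M0: "0 \<le> M"
    using order_trans[OF norm_ge_zero, of "p 0" M] by simp
  have e2_le: "(e t)\<^sup>2 \<le> E\<^sup>2" if "0 \<le> t" for t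
    using e_le[OF that] E by (simp add: abs_le_square_iff[symmetric])
  have p2_le: "(norm (p t))\<^sup>2 \<le> M\<^sup>2" if "0 \<le> t" for t
    using p_le[OF that] by (simp add: power_mono)
  have w_nonneg: "0 \<le> w t" for t
    by (simp add: w_def)

  \<comment> \<open>Only the first term of the derivative contains the estimate, so \<open>w t\<close> enters linearly.\<close>
  have e2_slope: "- (2 * (e t * e' t)) \<le>
      (2 * \<bar>b\<bar> * \<kappa> * E\<^sup>2 + \<bar>b\<bar> * \<gamma> * (M\<^sup>2 * E\<^sup>2)) + 2 * \<bar>b\<bar> * E * M * w t" if t: "0 \<le> t" for t
  proof -
    have "\<bar>(\<theta> - \<theta>hat t) \<bullet> p t\<bar> \<le> w t * M"
      unfolding w_def using p_le[OF t]
      by (intro order_trans[OF Cauchy_Schwarz_ineq2] mult_left_mono) auto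
    then have "\<bar>e t\<bar> * \<bar>(\<theta> - \<theta>hat t) \<bullet> p t\<bar> \<le> E * (w t * M)"
      using e_le[OF t] E by (intro mult_mono) auto
    then have "2 * \<bar>b\<bar> * (\<bar>e t\<bar> * \<bar>(\<theta> - \<theta>hat t) \<bullet> p t\<bar>) \<le> 2 * \<bar>b\<bar> * (E * (w t * M))"
      by (rule mult_left_mono) simp
    moreover have "- (2 * b * (e t * ((\<theta> - \<theta>hat t) \<bullet> p t)))
        \<le> 2 * \<bar>b\<bar> * (\<bar>e t\<bar> * \<bar>(\<theta> - \<theta>hat t) \<bullet> p t\<bar>)"
      using abs_ge_minus_self[of "2 * b * (e t * ((\<theta> - \<theta>hat t) \<bullet> p t))"] by (simp add: abs_mult)
    moreover have "2 * \<bar>b\<bar> * \<kappa> * (e t)\<^sup>2 \<le> 2 * \<bar>b\<bar> * \<kappa> * E\<^sup>2"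
      using e2_le[OF t] design by (intro mult_left_mono) auto
    moreover have "\<bar>b\<bar> * \<gamma> * ((norm (p t))\<^sup>2 * (e t)\<^sup>2) \<le> \<bar>b\<bar> * \<gamma> * (M\<^sup>2 * E\<^sup>2)"
      using e2_le[OF t] p2_le[OF t] design by (intro mult_left_mono mult_mono) auto
    moreover have "- (2 * (e t * e' t)) = - (2 * b * (e t * ((\<theta> - \<theta>hat t) \<bullet> p t)))
        + 2 * \<bar>b\<bar> * \<kappa> * (e t)\<^sup>2 + \<bar>b\<bar> * \<gamma> * ((norm (p t))\<^sup>2 * (e t)\<^sup>2)"
      unfolding e'_def by (simp add: algebra_simps power2_eq_square)
    moreover have "2 * \<bar>b\<bar> * (E * (w t * M)) = 2 * \<bar>b\<bar> * E * M * w t"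
      by simp
    ultimately show ?thesis by linarith
  qed
  have "((\<lambda>t. (e t)\<^sup>2) \<longlongrightarrow> 0) at_top"
  proof (rule tendsto_0_if_integral_bounded[OF e2_cont _ e2_int])
    show "\<exists>\<delta>>0. \<forall>t\<ge>0. \<forall>s\<in>{t..t + \<delta>}. (e t)\<^sup>2 \<le> (e s)\<^sup>2 + \<eta>" if "0 < \<eta>" for \<eta>
      by (rule short_time_drop_bound[OF tau _ _ _ e2_cont e2_deriv e2_slope w_int w_window that])
        (use E M0 design V_nonneg in auto)
  qed simp_all
  then have e_lim: "(e \<longlongrightarrow> 0) at_top"
    using tendsto_real_sqrt[of "\<lambda>t. (e t)\<^sup>2" 0 at_top] tendsto_rabs_zero_iff[of e at_top] by simp

  have \<theta>hat_window: "bounded ((\<lambda>t. integral {t - \<tau>..t} (\<lambda>s. (norm (\<theta>hat s))\<^sup>2)) ` {\<tau>..})"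
  proof (rule bounded_window_integral[OF tau _ \<theta>hat_int w_int w_window])
    fix s :: real
    have "norm (\<theta>hat s) \<le> norm \<theta> + w s"
      unfolding w_def using norm_triangle_ineq4[of \<theta> "\<theta> - \<theta>hat s"] by simp
    then have "(norm (\<theta>hat s))\<^sup>2 \<le> (norm \<theta> + w s)\<^sup>2"
      by (simp add: power_mono)
    also have "\<dots> \<le> 2 * (norm \<theta>)\<^sup>2 + 2 * (w s)\<^sup>2"
      using sum_squares_ge_zero[of "norm \<theta> - w s" 0] by (simp add: power2_eq_square algebra_simps)
    finally show "0 \<le> (norm (\<theta>hat s))\<^sup>2 \<and> (norm (\<theta>hat s))\<^sup>2 \<le> 2 * (norm \<theta>)\<^sup>2 + 2 * (w s)\<^sup>2"
      by simp
  qed simp_all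

  define D where "D = \<kappa> * E + norm \<theta> * M + \<gamma> * (M\<^sup>2 * E) / 2"
  have u_window: "bounded ((\<lambda>t. integral {t - \<tau>..t} (\<lambda>s. (u s)\<^sup>2)) ` {\<tau>..})"
  proof (rule bounded_window_integral[OF tau _ u_int w_int w_window])
    fix s :: real
    assume s: "0 \<le> s"
    have "\<bar>sgn b * \<kappa> * e s\<bar> \<le> \<kappa> * E"
      using e_le[OF s] design b by (simp add: abs_mult abs_sgn_eq)
    moreover have "\<bar>\<theta>hat s \<bullet> p s\<bar> \<le> norm \<theta> * M + M * w s"
    proof -
      have "norm (\<theta>hat s) \<le> norm \<theta> + w s"
        unfolding w_def using norm_triangle_ineq4[of \<theta> "\<theta> - \<theta>hat s"] by simp
      then have "norm (\<theta>hat s) * norm (p s) \<le> (norm \<theta> + w s) * M"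
        using p_le[OF s] w_nonneg[of s] by (intro mult_mono) auto
      then show ?thesis
        using Cauchy_Schwarz_ineq2[of "\<theta>hat s" "p s"] by (simp add: algebra_simps)
    qed
    moreover have "\<bar>(1/2) * sgn b * \<gamma> * (norm (p s))\<^sup>2 * e s\<bar> \<le> \<gamma> * (M\<^sup>2 * E) / 2"
    proof -
      have "(norm (p s))\<^sup>2 * \<bar>e s\<bar> \<le> M\<^sup>2 * E"
        using p2_le[OF s] e_le[OF s] by (intro mult_mono) auto
      then show ?thesis
        using design b by (simp add: abs_mult abs_sgn_eq)
    qed
    ultimately have "\<bar>u s\<bar> \<le> D + M * w s"
      unfolding D_def using u_eq[OF s] by linarith
    then have "(u s)\<^sup>2 \<le> (D + M * w s)\<^sup>2"
      using power_mono[of "\<bar>u s\<bar>" "D + M * w s" 2] by simp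
    also have "\<dots> \<le> 2 * D\<^sup>2 + 2 * M\<^sup>2 * (w s)\<^sup>2"
      using sum_squares_ge_zero[of "D - M * w s" 0] by (simp add: power2_eq_square algebra_simps)
    finally show "0 \<le> (u s)\<^sup>2 \<and> (u s)\<^sup>2 \<le> 2 * D\<^sup>2 + 2 * M\<^sup>2 * (w s)\<^sup>2"
      by simp
  qed simp_all

  have "bounded (e ` {0..})"
    using e_le by (auto simp: bounded_iff)
  moreover have "bounded (x ` {0..})"
    using x_le by (auto simp: bounded_iff)
  ultimately show ?thesis
    using e_lim \<theta>hat_window u_window \<theta>hat_int u_int by simp
qed

end
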